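(* Let $d\ge2$, $r>0$, let $f^{dis}:\mathbb{Z}^d\to\mathbb{C}$ satisfy $\operatorname{supp} f^{dis}\subseteq B_r\cap\mathbb{Z}^d$, and let $f$ be the distribution on $\mathbb{R}^d$ given by $$f(x)=\sum_{z\in\mathbb{Z}^d}f^{dis}(z)\,\delta(x-z),\quad x\in\mathbb{R}^d,$$ where $\delta$ is the Dirac delta function. Then for every $\theta\in\mathbb{S}^{d-1}$, $$(\mathcal{P}^{con}f)_\theta(x)=\sum_{\zeta\in X_\theta^{dis}}(\mathcal{P}^{dis}f^{dis})_\theta(\zeta)\,\delta(x-\zeta),\quad x\in X_\theta,$$ as distributions on $X_\theta$, where on the right $\delta$ is the Dirac delta function on $X_\theta$.
   Context: $B_r=\{x\in\mathbb{R}^d:|x|\le r\}$. For $\theta\in\mathbb{S}^{d-1}$: $X_\theta=\{x\in\mathbb{R}^d: x\cdot\theta=0\}$, $\pi_\theta$ is the orthogonal projection of $\mathbb{R}^d$ onto $X_\theta$, and $X_\theta^{dis}=\pi_\theta\mathbb{Z}^d$. Continuous X-ray transform: $(\mathcal{P}^{con}f)_\theta(x)=\mathcal{P}^{con}f(\theta,x)=\int_{\mathbb{R}}f(x+s\theta)\,ds$, $x\in X_\theta$, for test functions $f$ on $\mathbb{R}^d$; for a compactly supported distribution $f$ on $\mathbb{R}^d$, $(\mathcal{P}^{con}f)_\theta$ is the distribution on $X_\theta$ defined by $\langle(\mathcal{P}^{con}f)_\theta,\varphi\rangle=\langle f,\varphi\circ\pi_\theta\rangle$ for $\varphi\in C_c^\infty(X_\theta)$.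 Discrete X-ray transform: for $g:\mathbb{Z}^d\to\mathbb{C}$ of finite support, $(\mathcal{P}^{dis}g)_\theta(x)=\mathcal{P}^{dis}g(\theta,x)=\sum_{s\in\mathbb{R},\,x+s\theta\in\mathbb{Z}^d}g(x+s\theta)$, $x\in X_\theta^{dis}$. *)

theory Defs
  imports "HOL-Analysis.Analysis"
begin

text \<open>
  Distributions on a linear subspace \<open>V\<close> of a Euclidean space; \<open>V = UNIV\<close> is the whole space.
  A function on \<open>V\<close> is represented by its extension by zero to the ambient type, and a
  distribution on \<open>V\<close> by a functional that is extensional on the test functions on \<open>V\<close>, so
  equality of distributions is equality of functions.
\<close>

text \<open>
  The Frechet derivative within a proper subspace \<open>V\<close> is determined only on \<open>V\<close>;
  accordingly \<open>dir_deriv V v\<close> is meaningful for \<open>v \<in> V\<close> and at points of \<open>V\<close>.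
\<close>

definition dir_deriv ::
    "'a::euclidean_space set \<Rightarrow> 'a \<Rightarrow> ('a \<Rightarrow> complex) \<Rightarrow> 'a \<Rightarrow> complex" where
  "dir_deriv V v \<phi> x = frechet_derivative \<phi> (at x within V) v"

definition iter_deriv ::
    "'a::euclidean_space set \<Rightarrow> 'a list \<Rightarrow> ('a \<Rightarrow> complex) \<Rightarrow> 'a \<Rightarrow> complex" where
  "iter_deriv V vs \<phi> = foldr (dir_deriv V) vs \<phi>"

definition smooth_fun_on :: "'a::euclidean_space set \<Rightarrow> ('a \<Rightarrow> complex) \<Rightarrow> bool" where
  "smooth_fun_on V \<phi> \<longleftrightarrow> (\<forall>vs \<in> lists V. iter_deriv V vs \<phi> differentiable_on V)"

definition fun_support :: "('a::euclidean_space \<Rightarrow> complex) \<Rightarrow> 'a set" where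
  "fun_support \<phi> = closure {x. \<phi> x \<noteq> 0}"

definition test_functions :: "'a::euclidean_space set \<Rightarrow> ('a \<Rightarrow> complex) set" where
  "test_functions V =
     {\<phi>. smooth_fun_on V \<phi> \<and> compact (fun_support \<phi>) \<and> (\<forall>x. x \<notin> V \<longrightarrow> \<phi> x = 0)}"

definition test_null_seq ::
    "'a::euclidean_space set \<Rightarrow> (nat \<Rightarrow> 'a \<Rightarrow> complex) \<Rightarrow> bool" where
  "test_null_seq V \<phi> \<longleftrightarrow>
     (\<forall>n. \<phi> n \<in> test_functions V) \<and>
     (\<exists>K. compact K \<and> (\<forall>n. fun_support (\<phi> n) \<subseteq> K)) \<and>
     (\<forall>vs \<in> lists V. uniform_limit V (\<lambda>n. iter_deriv V vs (\<phi> n)) (\<lambda>_. 0) sequentially)"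

definition distributions ::
    "'a::euclidean_space set \<Rightarrow> (('a \<Rightarrow> complex) \<Rightarrow> complex) set" where
  "distributions V =
     {T \<in> extensional (test_functions V).
        (\<forall>\<phi> \<in> test_functions V. \<forall>\<psi> \<in> test_functions V.
           T (\<lambda>x. \<phi> x + \<psi> x) = T \<phi> + T \<psi>) \<and>
        (\<forall>c. \<forall>\<phi> \<in> test_functions V. T (\<lambda>x. c * \<phi> x) = c * T \<phi>) \<and>
        (\<forall>\<phi>. test_null_seq V \<phi> \<longrightarrow> (\<lambda>n. T (\<phi> n)) \<longlonglongrightarrow> 0)}"

definition distr_support ::
    "'a::euclidean_space set \<Rightarrow> (('a \<Rightarrow> complex) \<Rightarrow> complex) \<Rightarrow> 'a set" where
  "distr_support V T =
     {x \<in> V. \<forall>U. open U \<and> x \<in> U \<longrightarrow>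
        (\<exists>\<phi> \<in> test_functions V. fun_support \<phi> \<subseteq> U \<and> T \<phi> \<noteq> 0)}"

definition compact_distributions ::
    "'a::euclidean_space set \<Rightarrow> (('a \<Rightarrow> complex) \<Rightarrow> complex) set" where
  "compact_distributions V = {T \<in> distributions V. compact (distr_support V T)}"

text \<open>
  The pairing of a compactly supported distribution with a smooth function \<open>\<psi>\<close> that need not
  have compact support: the common value of \<open>T (\<eta> \<psi>)\<close> over all cutoff functions \<open>\<eta>\<close> equal
  to 1 in a neighbourhood of the support of \<open>T\<close>.
\<close>

definition distr_pairing ::
    "'a::euclidean_space set \<Rightarrow> (('a \<Rightarrow> complex) \<Rightarrow> complex) \<Rightarrow> ('a \<Rightarrow> complex) \<Rightarrow> complex" where
  "distr_pairing V T \<psi> =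
     (THE c. \<forall>\<eta> \<in> test_functions V.
        (\<exists>U. open U \<and> distr_support V T \<subseteq> U \<and> (\<forall>x \<in> U \<inter> V. \<eta> x = 1)) \<longrightarrow>
        T (\<lambda>x. \<eta> x * \<psi> x) = c)"

definition dirac :: "'a::euclidean_space set \<Rightarrow> 'a \<Rightarrow> ('a \<Rightarrow> complex) \<Rightarrow> complex" where
  "dirac V a = (\<lambda>\<phi> \<in> test_functions V. \<phi> a)"

definition dirac_sum ::
    "'a::euclidean_space set \<Rightarrow> 'a set \<Rightarrow> ('a \<Rightarrow> complex) \<Rightarrow> ('a \<Rightarrow> complex) \<Rightarrow> complex" where
  "dirac_sum V A w = (\<lambda>\<phi> \<in> test_functions V. \<Sum>\<^sub>\<infinity>a\<in>A. w a * dirac V a \<phi>)"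

definition int_lattice :: "(real ^ 'n) set" where
  "int_lattice = {z. \<forall>i. z $ i \<in> \<int>}"

definition hyperplane :: "real ^ 'n \<Rightarrow> (real ^ 'n) set" where
  "hyperplane \<theta> = {x. x \<bullet> \<theta> = 0}"

text \<open>For \<open>\<theta>\<close> of norm 1 this is the orthogonal projection onto \<open>hyperplane \<theta>\<close>.\<close>

definition hproj :: "real ^ 'n \<Rightarrow> real ^ 'n \<Rightarrow> real ^ 'n" where
  "hproj \<theta> x = x - (x \<bullet> \<theta>) *\<^sub>R \<theta>"

lemma hproj_orthogonal_projection:
  assumes "norm \<theta> = 1"
  shows "hproj \<theta> x \<in> hyperplane \<theta>"
    and "y \<in> hyperplane \<theta> \<Longrightarrow> orthogonal (x - hproj \<theta> x) y"
  using assms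
  by (auto simp: hproj_def hyperplane_def orthogonal_def inner_diff_left inner_diff_right inner_commute norm_eq_1)

definition hyperplane_dis :: "real ^ 'n \<Rightarrow> (real ^ 'n) set" where
  "hyperplane_dis \<theta> = hproj \<theta> ` int_lattice"

definition xray_con ::
    "((real ^ 'n \<Rightarrow> complex) \<Rightarrow> complex) \<Rightarrow> real ^ 'n \<Rightarrow> (real ^ 'n \<Rightarrow> complex) \<Rightarrow> complex" where
  "xray_con f \<theta> =
     (\<lambda>\<phi> \<in> test_functions (hyperplane \<theta>). distr_pairing UNIV f (\<phi> \<circ> hproj \<theta>))"

text \<open>
  Only the values of \<open>g\<close> on the integer lattice matter; for \<open>g\<close> of finite support there
  the sum has finitely many nonzero terms.
\<close>

definition xray_dis :: "(real ^ 'n \<Rightarrow> complex) \<Rightarrow> real ^ 'n \<Rightarrow> real ^ 'n \<Rightarrow> complex" where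
  "xray_dis g \<theta> x = (\<Sum>\<^sub>\<infinity>s \<in> {s. x + s *\<^sub>R \<theta> \<in> int_lattice}. g (x + s *\<^sub>R \<theta>))"

end

theory Submission imports Defs begin

text \<open>
  Both sides of the identity are finite combinations of point evaluations. Let \<open>S\<close> be the
  finite set of lattice points at which \<open>fdis\<close> does not vanish. Then \<open>f\<close> maps a test
  function \<open>\<phi>\<close> to \<open>\<Sum>z\<in>S. fdis z * \<phi> z\<close>, so pairing \<open>f\<close> with
  \<open>\<phi> \<circ> hproj \<theta>\<close> gives \<open>\<Sum>z\<in>S. fdis z * \<phi> (hproj \<theta> z)\<close>. Grouping the points of \<open>S\<close>
  by their projection turns this into a sum over the projected lattice, and the weight collected
  at a projected point is the sum of \<open>fdis\<close> over the line through it in direction \<open>\<theta>\<close>,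
  that is, the discrete X-ray transform (\<open>dirac_sum_xray_dis\<close>).

  The analytic work lies in the pairing. It is defined through cutoff functions that equal 1 near
  the support of \<open>f\<close>, so its value is \<open>\<Sum>z\<in>S. fdis z * \<psi> z\<close> only because the support
  is all of \<open>S\<close> and a cutoff exists, and because test functions are closed under
  multiplication by smooth functions
  (\<open>distr_pairing_finite_point_evaluations\<close>). The cutoffs come from \<open>exp (-1/t)\<close>
  (\<open>smooth_cutoff_exists\<close>). Smoothness is handled through a recursive notion of finite order
  of differentiability, for which sums, products, composition with linear maps and composition with
  the flat functions are dealt with by induction on the order.
\<close>

section \<open>Derivatives within a subspace\<close>

text \<open>
  Only the value of the derivative at vectors of \<open>V\<close> is determined, which is why \<open>v\<close> is
  restricted here: off \<open>V\<close>, \<open>frechet_derivative\<close> makes an arbitrary choice.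
\<close>

lemma dir_deriv_eq:
  assumes V: "subspace V" and D: "(\<phi> has_derivative D) (at x within V)"
    and x: "x \<in> V" and v: "v \<in> V"
  shows "dir_deriv V v \<phi> x = D v"
proof -
  \<comment> \<open>Along the line \<open>t \<mapsto> x + t v\<close>, which stays in \<open>V\<close>, derivatives are unique.\<close>
  define \<gamma> where "\<gamma> t = x + t *\<^sub>R v" for t :: real
  have \<gamma>: "(\<gamma> has_derivative (\<lambda>t. t *\<^sub>R v)) (at 0)"
    unfolding \<gamma>_def by (auto intro!: derivative_eq_intros)
  have sub: "range \<gamma> \<subseteq> V"
    using V x v by (auto simp: \<gamma>_def subspace_add subspace_scale)
  have line: "((\<phi> \<circ> \<gamma>) has_derivative (E \<circ> (\<lambda>t. t *\<^sub>R v))) (at 0)"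
    if "(\<phi> has_derivative E) (at x within V)" for E
  proof -
    have "(\<phi> has_derivative E) (at (\<gamma> 0) within range \<gamma>)"
      using has_derivative_subset[OF that sub] by (simp add: \<gamma>_def)
    with \<gamma> show ?thesis by (rule diff_chain_within)
  qed
  have "(\<phi> has_derivative frechet_derivative \<phi> (at x within V)) (at x within V)"
    using D differentiable_def frechet_derivative_works by blast
  from has_derivative_unique[OF line[OF this] line[OF D]]
  have "frechet_derivative \<phi> (at x within V) (1 *\<^sub>R v) = D (1 *\<^sub>R v)"
    unfolding o_def by (rule fun_cong)
  then show ?thesis
    by (simp add: dir_deriv_def)
qed

lemma differentiable_on_cong:
  assumes "\<phi> differentiable_on V" "\<And>x. x \<in> V \<Longrightarrow> \<phi> x = \<psi> x"
  shows "\<psi> differentiable_on V"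
  unfolding differentiable_on_def
proof
  fix x assume x: "x \<in> V"
  then obtain D where "(\<phi> has_derivative D) (at x within V)"
    using assms(1) by (auto simp: differentiable_on_def differentiable_def)
  then have "(\<psi> has_derivative D) (at x within V)"
    by (rule has_derivative_transform[OF x, rotated]) (simp add: assms(2))
  then show "\<psi> differentiable at x within V"
    by (auto simp: differentiable_def)
qed

lemma dir_deriv_cong:
  assumes "\<And>x. x \<in> V \<Longrightarrow> \<phi> x = \<psi> x" "x \<in> V"
  shows "dir_deriv V v \<phi> x = dir_deriv V v \<psi> x"
proof -
  have "(\<phi> has_derivative D) (at x within V) \<longleftrightarrow> (\<psi> has_derivative D) (at x within V)" for D
    using has_derivative_transform[OF assms(2), of \<psi> \<phi> D]
      has_derivative_transform[OF assms(2), of \<phi> \<psi> D] assms(1) by auto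
  then show ?thesis
    by (simp add: dir_deriv_def frechet_derivative_def)
qed

text \<open>
  All iterated directional derivatives of order at most \<open>n\<close> are differentiable. The recursion
  takes the innermost derivative first, which is the order needed for induction over sums,
  products and compositions.
\<close>

primrec iter_differentiable_on ::
    "'a::euclidean_space set \<Rightarrow> nat \<Rightarrow> ('a \<Rightarrow> complex) \<Rightarrow> bool" where
  "iter_differentiable_on V 0 \<phi> \<longleftrightarrow> \<phi> differentiable_on V"
| "iter_differentiable_on V (Suc n) \<phi> \<longleftrightarrow>
     \<phi> differentiable_on V \<and> (\<forall>v\<in>V. iter_differentiable_on V n (dir_deriv V v \<phi>))"

lemma iter_differentiable_on_iff:
  "iter_differentiable_on V n \<phi> \<longleftrightarrow>
     (\<forall>vs\<in>lists V. length vs \<le> n \<longrightarrow> iter_deriv V vs \<phi> differentiable_on V)"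
proof (induction n arbitrary: \<phi>)
  case 0
  then show ?case by (auto simp: iter_deriv_def)
next
  case (Suc n)
  have "(\<forall>vs\<in>lists V. length vs \<le> Suc n \<longrightarrow> iter_deriv V vs \<phi> differentiable_on V) \<longleftrightarrow>
    \<phi> differentiable_on V \<and>
    (\<forall>v\<in>V. \<forall>vs\<in>lists V. length vs \<le> n \<longrightarrow> iter_deriv V vs (dir_deriv V v \<phi>) differentiable_on V)"
    (is "?L \<longleftrightarrow> ?R")
  proof
    assume L: ?L
    have "iter_deriv V vs (dir_deriv V v \<phi>) differentiable_on V"
      if "v \<in> V" "vs \<in> lists V" "length vs \<le> n" for v vs
      using L[rule_format, of "vs @ [v]"] that by (simp add: iter_deriv_def)
    moreover have "\<phi> differentiable_on V"
      using L[rule_format, of "[]"] by (simp add: iter_deriv_def)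
    ultimately show ?R by blast
  next
    assume R: ?R
    have "iter_deriv V vs \<phi> differentiable_on V" if "vs \<in> lists V" "length vs \<le> Suc n" for vs
      using that R by (cases vs rule: rev_cases) (auto simp: iter_deriv_def)
    then show ?L by blast
  qed
  then show ?case by (simp add: Suc)
qed

lemma smooth_fun_on_iff: "smooth_fun_on V \<phi> \<longleftrightarrow> (\<forall>n. iter_differentiable_on V n \<phi>)"
  by (auto simp: smooth_fun_on_def iter_differentiable_on_iff)

lemma iter_differentiable_on_imp_differentiable_on:
  "iter_differentiable_on V n \<phi> \<Longrightarrow> \<phi> differentiable_on V"
  by (cases n) auto

lemma iter_differentiable_on_SucD:
  "iter_differentiable_on V (Suc n) \<phi> \<Longrightarrow> iter_differentiable_on V n \<phi>"
  by (auto simp: iter_differentiable_on_iff)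

lemma iter_differentiable_on_has_derivative:
  assumes "iter_differentiable_on V n \<phi>" "x \<in> V"
  shows "(\<phi> has_derivative (\<lambda>v. dir_deriv V v \<phi> x)) (at x within V)"
  using iter_differentiable_on_imp_differentiable_on[OF assms(1)] assms(2)
  by (simp add: differentiable_on_def dir_deriv_def frechet_derivative_works)

lemma iter_differentiable_on_cong:
  assumes "iter_differentiable_on V n \<phi>" "\<And>x. x \<in> V \<Longrightarrow> \<phi> x = \<psi> x"
  shows "iter_differentiable_on V n \<psi>"
  using assms
proof (induction n arbitrary: \<phi> \<psi>)
  case 0
  then show ?case
    unfolding iter_differentiable_on.simps by (rule differentiable_on_cong)
next
  case (Suc n)
  have \<phi>: "\<phi> differentiable_on V" "\<And>v. v \<in> V \<Longrightarrow> iter_differentiable_on V n (dir_deriv V v \<phi>)"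
    using Suc.prems(1) by auto
  have "iter_differentiable_on V n (dir_deriv V v \<psi>)" if "v \<in> V" for v
    using \<phi>(2)[OF that] dir_deriv_cong[OF Suc.prems(2)] by (rule Suc.IH)
  moreover have "\<psi> differentiable_on V"
    using \<phi>(1) Suc.prems(2) by (rule differentiable_on_cong)
  ultimately show ?case by simp
qed

lemma iter_differentiable_on_0I:
  assumes "\<And>x. x \<in> V \<Longrightarrow> (\<phi> has_derivative D x) (at x within V)"
  shows "iter_differentiable_on V 0 \<phi>"
  using assms by (auto simp: differentiable_on_def differentiable_def)

lemma iter_differentiable_on_SucI:
  assumes V: "subspace V" and D: "\<And>x. x \<in> V \<Longrightarrow> (\<phi> has_derivative D x) (at x within V)"
    and "\<And>v. v \<in> V \<Longrightarrow> iter_differentiable_on V n (\<lambda>x. D x v)"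
  shows "iter_differentiable_on V (Suc n) \<phi>"
proof -
  have "iter_differentiable_on V n (dir_deriv V v \<phi>)" if "v \<in> V" for v
    using assms(3)[OF that] by (rule iter_differentiable_on_cong) (simp add: dir_deriv_eq[OF V D _ that])
  with iter_differentiable_on_0I[OF D] show ?thesis by simp
qed

section \<open>Closure properties of smooth functions\<close>

lemma iter_differentiable_on_const:
  assumes "subspace V"
  shows "iter_differentiable_on V n (\<lambda>x. c)"
proof (induction n arbitrary: c)
  case (Suc n)
  then show ?case
    by (intro iter_differentiable_on_SucI[OF assms, where D = "\<lambda>x v. 0"]) auto
qed auto

lemma iter_differentiable_on_add:
  assumes "subspace V" "iter_differentiable_on V n \<phi>" "iter_differentiable_on V n \<psi>"
  shows "iter_differentiable_on V n (\<lambda>x. \<phi> x + \<psi> x)"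
  using assms(2,3)
proof (induction n arbitrary: \<phi> \<psi>)
  case (Suc n)
  show ?case
  proof (rule iter_differentiable_on_SucI[OF assms(1)])
    show "((\<lambda>x. \<phi> x + \<psi> x) has_derivative (\<lambda>v. dir_deriv V v \<phi> x + dir_deriv V v \<psi> x))
        (at x within V)" if "x \<in> V" for x
      by (rule has_derivative_add[OF Suc.prems[THEN iter_differentiable_on_has_derivative, OF that]])
    show "iter_differentiable_on V n (\<lambda>x. dir_deriv V v \<phi> x + dir_deriv V v \<psi> x)"
      if "v \<in> V" for v
      using that Suc by simp
  qed
qed auto

lemma iter_differentiable_on_mult:
  assumes "subspace V" "iter_differentiable_on V n \<phi>" "iter_differentiable_on V n \<psi>"
  shows "iter_differentiable_on V n (\<lambda>x. \<phi> x * \<psi> x)"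
  using assms(2,3)
proof (induction n arbitrary: \<phi> \<psi>)
  case 0
  then show ?case by (auto simp: differentiable_on_def)
next
  case (Suc n)
  show ?case
  proof (rule iter_differentiable_on_SucI[OF assms(1)])
    show "((\<lambda>x. \<phi> x * \<psi> x) has_derivative
        (\<lambda>v. \<phi> x * dir_deriv V v \<psi> x + dir_deriv V v \<phi> x * \<psi> x)) (at x within V)"
      if "x \<in> V" for x
      by (rule has_derivative_mult[OF Suc.prems[THEN iter_differentiable_on_has_derivative, OF that]])
    show "iter_differentiable_on V n (\<lambda>x. \<phi> x * dir_deriv V v \<psi> x + dir_deriv V v \<phi> x * \<psi> x)"
      if "v \<in> V" for v
    proof (rule iter_differentiable_on_add[OF assms(1)])
      show "iter_differentiable_on V n (\<lambda>x. \<phi> x * dir_deriv V v \<psi> x)"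
        by (rule Suc.IH[OF iter_differentiable_on_SucD[OF Suc.prems(1)]]) (use Suc.prems that in simp)
      show "iter_differentiable_on V n (\<lambda>x. dir_deriv V v \<phi> x * \<psi> x)"
        by (rule Suc.IH[OF _ iter_differentiable_on_SucD[OF Suc.prems(2)]]) (use Suc.prems that in simp)
    qed
  qed
qed

lemma iter_differentiable_on_affine:
  assumes "subspace V" "iter_differentiable_on V n \<phi>"
  shows "iter_differentiable_on V n (\<lambda>x. c + d * \<phi> x)"
  by (rule iter_differentiable_on_add[OF assms(1) iter_differentiable_on_const[OF assms(1)]
        iter_differentiable_on_mult[OF assms(1) iter_differentiable_on_const[OF assms(1)] assms(2)]])

lemma iter_differentiable_on_compose_linear:
  assumes W: "subspace W" and L: "bounded_linear L" "L ` W \<subseteq> V"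
    and "iter_differentiable_on V n \<phi>"
  shows "iter_differentiable_on W n (\<phi> \<circ> L)"
  using assms(4)
proof (induction n arbitrary: \<phi>)
  have chain: "((\<phi> \<circ> L) has_derivative (\<lambda>v. dir_deriv V (L v) \<phi> (L x))) (at x within W)"
    if "iter_differentiable_on V n \<phi>" "x \<in> W" for n \<phi> x
  proof -
    have "(\<phi> has_derivative (\<lambda>v. dir_deriv V v \<phi> (L x))) (at (L x) within L ` W)"
      using L(2) that(2)
      by (intro has_derivative_subset[OF iter_differentiable_on_has_derivative[OF that(1)] L(2)]) auto
    from diff_chain_within[OF bounded_linear_imp_has_derivative[OF L(1)] this]
    show ?thesis by (simp add: o_def)
  qed
  { case 0
    show ?case using chain[OF 0] by (rule iter_differentiable_on_0I) }
  { case (Suc n)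
    show ?case
    proof (rule iter_differentiable_on_SucI[OF W chain[OF Suc.prems]])
      show "iter_differentiable_on W n (\<lambda>x. dir_deriv V (L v) \<phi> (L x))" if "v \<in> W" for v
        using Suc.IH[of "dir_deriv V (L v) \<phi>"] Suc.prems that L by (auto simp: o_def)
    qed }
qed

section \<open>Supports\<close>

lemma fun_support_subset_closed: "closed S \<Longrightarrow> {x. \<phi> x \<noteq> 0} \<subseteq> S \<Longrightarrow> fun_support \<phi> \<subseteq> S"
  unfolding fun_support_def by (rule closure_minimal)

lemma compact_fun_support_subset:
  assumes "compact K" "{x. \<phi> x \<noteq> 0} \<subseteq> K"
  shows "compact (fun_support \<phi>)"
proof -
  have "fun_support \<phi> \<subseteq> K"
    using compact_imp_closed[OF assms(1)] assms(2) by (rule fun_support_subset_closed)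
  moreover have "closed (fun_support \<phi>)" by (simp add: fun_support_def)
  ultimately show ?thesis
    using assms(1) by (metis compact_Int_closed inf.absorb2)
qed

lemma fun_support_superset: "{x. \<phi> x \<noteq> 0} \<subseteq> fun_support \<phi>"
  by (simp add: fun_support_def closure_subset)

section \<open>Smooth cutoff functions\<close>

text \<open>
  The functions \<open>p (1/t) exp (-1/t)\<close> for \<open>t > 0\<close>, extended by zero, with \<open>p\<close> a polynomial.
  This family is closed under differentiation, so its members are smooth; \<open>p = 1\<close> is the
  standard flat function.
\<close>

definition flat_fun :: "real poly \<Rightarrow> real \<Rightarrow> real" where
  "flat_fun p t = (if t > 0 then poly p (inverse t) * exp (- inverse t) else 0)"

lemma tendsto_poly_mult_exp_neg: "((\<lambda>x::real. poly p x * exp (- x)) \<longlongrightarrow> 0) at_top"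
proof -
  have "((\<lambda>x::real. \<Sum>i\<le>degree p. coeff p i * (x ^ i / exp x)) \<longlongrightarrow> (\<Sum>i\<le>degree p. coeff p i * 0)) at_top"
    by (intro tendsto_intros tendsto_power_div_exp_0)
  then show ?thesis
    by (simp add: poly_altdef sum_divide_distrib exp_minus divide_inverse sum_distrib_right mult.assoc)
qed

lemma flat_fun_has_derivative:
  "(flat_fun p has_real_derivative flat_fun ([:0, 0, 1:] * (p - pderiv p)) t) (at t)"
proof -
  consider "t > 0" | "t < 0" | "t = 0" by linarith
  then show ?thesis
  proof cases
    case 1
    have "((\<lambda>t. poly p (inverse t) * exp (- inverse t)) has_real_derivative
        flat_fun ([:0, 0, 1:] * (p - pderiv p)) t) (at t)"
      using 1 by (auto intro!: derivative_eq_intros DERIV_chain2[OF poly_DERIV]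
          simp: flat_fun_def field_simps power2_eq_square)
    then show ?thesis
      by (rule has_field_derivative_transform_within_open[of _ _ _ "{0<..}"])
        (use 1 in \<open>auto simp: flat_fun_def\<close>)
  next
    case 2
    have "((\<lambda>t. 0) has_real_derivative flat_fun ([:0, 0, 1:] * (p - pderiv p)) t) (at t)"
      using 2 by (simp add: flat_fun_def)
    then show ?thesis
      by (rule has_field_derivative_transform_within_open[of _ _ _ "{..<0}"])
        (use 2 in \<open>auto simp: flat_fun_def\<close>)
  next
    case 3
    \<comment> \<open>The factor \<open>1/h\<close> of the difference quotient is absorbed into the polynomial.\<close>
    have "((\<lambda>x. poly ([:0, 1:] * p) (inverse x) * exp (- inverse x)) \<longlongrightarrow> 0) (at_right (0::real))"
      using filterlim_compose[OF tendsto_poly_mult_exp_neg filterlim_inverse_at_top_right] .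
    then have R: "((\<lambda>h. flat_fun p h / h) \<longlongrightarrow> 0) (at_right 0)"
      by (rule Lim_transform_eventually)
        (auto simp: eventually_at_filter flat_fun_def field_simps)
    have L: "((\<lambda>h. flat_fun p h / h) \<longlongrightarrow> 0) (at_left 0)"
      by (rule Lim_transform_eventually[OF tendsto_const])
        (auto simp: eventually_at_filter flat_fun_def)
    from L R have "((\<lambda>h. flat_fun p h / h) \<longlongrightarrow> 0) (at 0)"
      by (simp add: filterlim_at_split)
    then show ?thesis
      using 3 by (simp add: DERIV_def flat_fun_def)
  qed
qed

lemma iter_differentiable_on_flat_fun:
  assumes V: "subspace V" and "iter_differentiable_on V n (\<lambda>x. of_real (u x))"
  shows "iter_differentiable_on V n (\<lambda>x. of_real (flat_fun p (u x)))"
  using assms(2)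
proof (induction n arbitrary: p)
  define du where "du v x = dir_deriv V v (\<lambda>x. of_real (u x)) x" for v x
  have deriv: "((\<lambda>x. complex_of_real (u x)) has_derivative (\<lambda>v. of_real (Re (du v x)))) (at x within V)"
      "((\<lambda>x. complex_of_real (flat_fun p (u x))) has_derivative
        (\<lambda>v. of_real (Re (du v x) * flat_fun ([:0, 0, 1:] * (p - pderiv p)) (u x)))) (at x within V)"
    if "iter_differentiable_on V n (\<lambda>x. of_real (u x))" "x \<in> V" for n p x
  proof -
    have "((\<lambda>x. complex_of_real (u x)) has_derivative (\<lambda>v. du v x)) (at x within V)"
      unfolding du_def using iter_differentiable_on_has_derivative[OF that] .
    then have "((\<lambda>x. Re (complex_of_real (u x))) has_derivative (\<lambda>v. Re (du v x))) (at x within V)"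
      by (rule bounded_linear.has_derivative[OF bounded_linear_Re])
    then have u: "(u has_derivative (\<lambda>v. Re (du v x))) (at x within V)" by simp
    then show "((\<lambda>x. complex_of_real (u x)) has_derivative (\<lambda>v. of_real (Re (du v x)))) (at x within V)"
      by (rule bounded_linear.has_derivative[OF bounded_linear_of_real])
    have "((\<lambda>x. flat_fun p (u x)) has_derivative
        (\<lambda>v. Re (du v x) * flat_fun ([:0, 0, 1:] * (p - pderiv p)) (u x))) (at x within V)"
      using has_derivative_compose[OF u flat_fun_has_derivative[unfolded has_field_derivative_def]]
      by (simp add: mult.commute)
    then show "((\<lambda>x. complex_of_real (flat_fun p (u x))) has_derivative
        (\<lambda>v. of_real (Re (du v x) * flat_fun ([:0, 0, 1:] * (p - pderiv p)) (u x)))) (at x within V)"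
      by (rule bounded_linear.has_derivative[OF bounded_linear_of_real])
  qed
  { case 0
    show ?case using deriv(2)[OF 0] by (rule iter_differentiable_on_0I) }
  { case (Suc n)
    show ?case
    proof (rule iter_differentiable_on_SucI[OF V deriv(2)[OF Suc.prems]])
      fix v assume v: "v \<in> V"
      have "iter_differentiable_on V n
          (\<lambda>x. du v x * of_real (flat_fun ([:0, 0, 1:] * (p - pderiv p)) (u x)))"
      proof (rule iter_differentiable_on_mult[OF V _ Suc.IH[OF iter_differentiable_on_SucD[OF Suc.prems]]])
        show "iter_differentiable_on V n (du v)"
          unfolding du_def using Suc.prems v by simp
      qed
      \<comment> \<open>The differential of \<open>u\<close> takes real values in the directions of \<open>V\<close>.\<close>
      moreover have "du v x = of_real (Re (du v x))" if "x \<in> V" for x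
        using dir_deriv_eq[OF V deriv(1)[OF Suc.prems that] that v] by (simp add: du_def)
      ultimately show "iter_differentiable_on V n
          (\<lambda>x. of_real (Re (du v x) * flat_fun ([:0, 0, 1:] * (p - pderiv p)) (u x)))"
        by (elim iter_differentiable_on_cong) (metis of_real_mult)
    qed }
qed

text \<open>
  With \<open>g\<close> the flat function and \<open>m = g (b\<^sup>2 - a\<^sup>2)\<close>, the cutoff is
  \<open>1 - g (m - g (b\<^sup>2 - |x - z|\<^sup>2)) / g m\<close>: the inner value is at least \<open>m\<close> for
  \<open>|x - z| \<le> a\<close>, where the outer one vanishes, and is 0 for \<open>|x - z| \<ge> b\<close>. Nesting \<open>g\<close> in
  this way avoids division by a nonconstant function.
\<close>

lemma smooth_cutoff_exists:
  fixes z :: "'a::euclidean_space"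
  assumes "0 < a" "a < b"
  shows "\<exists>\<eta>\<in>test_functions UNIV. (\<forall>x. dist x z \<le> a \<longrightarrow> \<eta> x = 1) \<and> fun_support \<eta> \<subseteq> cball z b"
proof -
  define g where "g = flat_fun 1"
  have g0: "g t = 0" if "t \<le> 0" for t
    using that by (simp add: g_def flat_fun_def)
  have gpos: "0 < g t" if "0 < t" for t
    using that by (simp add: g_def flat_fun_def)
  have gmono: "g s \<le> g t" if "0 < s" "s \<le> t" for s t
    using that by (simp add: g_def flat_fun_def le_imp_inverse_le)
  define m where "m = g (b\<^sup>2 - a\<^sup>2)"
  have ab: "a\<^sup>2 < b\<^sup>2" using assms by (simp add: power_strict_mono)
  then have m: "0 < m" by (simp add: m_def gpos)
  define u where "u x = b\<^sup>2 - (x - z) \<bullet> (x - z)" for x :: 'a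
  define \<eta> where "\<eta> x = 1 + complex_of_real (- 1 / g m) * of_real (g (m + (- 1) * g (u x)))" for x :: 'a
  have affine: "iter_differentiable_on UNIV n (\<lambda>x. complex_of_real (c * ((x - z) \<bullet> v)))"
    for n c and v :: 'a
  proof (cases n)
    case 0
    have "((\<lambda>x. complex_of_real (c * ((x - z) \<bullet> v))) has_derivative
        (\<lambda>w. of_real (c * (w \<bullet> v)))) (at x)" for x
      by (auto intro!: derivative_eq_intros)
    then show ?thesis unfolding 0 by (rule iter_differentiable_on_0I)
  next
    case (Suc k)
    show ?thesis unfolding Suc
      by (rule iter_differentiable_on_SucI[where D = "\<lambda>x w. of_real (c * (w \<bullet> v))"])
        (auto intro!: derivative_eq_intros iter_differentiable_on_const)
  qed
  have du: "((\<lambda>x. complex_of_real (u x)) has_derivative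
      (\<lambda>w. of_real (- 2 * ((x - z) \<bullet> w)))) (at x)" for x
    unfolding u_def by (auto intro!: derivative_eq_intros simp: inner_commute)
  have "iter_differentiable_on UNIV n (\<lambda>x. complex_of_real (u x))" for n
  proof (cases n)
    case 0
    show ?thesis unfolding 0 using du by (rule iter_differentiable_on_0I)
  next
    case (Suc k)
    show ?thesis unfolding Suc
      by (rule iter_differentiable_on_SucI[OF _ du]) (use affine in \<open>simp_all only: subspace_UNIV\<close>)
  qed
  from iter_differentiable_on_flat_fun[OF subspace_UNIV this]
  have gu: "iter_differentiable_on UNIV n (\<lambda>x. complex_of_real (g (u x)))" for n
    by (simp add: g_def)
  have "iter_differentiable_on UNIV n (\<lambda>x. complex_of_real (m + (- 1) * g (u x)))" for n
    using iter_differentiable_on_affine[OF subspace_UNIV gu[of n], of "of_real m" "- 1"] by simp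
  from iter_differentiable_on_flat_fun[OF subspace_UNIV this]
  have "iter_differentiable_on UNIV n (\<lambda>x. complex_of_real (g (m + (- 1) * g (u x))))" for n
    by (simp add: g_def)
  from iter_differentiable_on_affine[OF subspace_UNIV this]
  have smooth: "smooth_fun_on UNIV \<eta>"
    unfolding smooth_fun_on_iff \<eta>_def by blast
  have u: "u x = b\<^sup>2 - (dist x z)\<^sup>2" for x
    by (simp add: u_def dist_norm power2_norm_eq_inner)
  have one: "\<eta> x = 1" if "dist x z \<le> a" for x
  proof -
    have "(dist x z)\<^sup>2 \<le> a\<^sup>2" using that by (simp add: power_mono)
    then have "m \<le> g (u x)"
      unfolding m_def u using ab by (intro gmono) auto
    then show ?thesis by (simp add: \<eta>_def g0)
  qed
  have zero: "\<eta> x = 0" if "b \<le> dist x z" for x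
  proof -
    have "b\<^sup>2 \<le> (dist x z)\<^sup>2" using that assms by (intro power_mono) auto
    then have "g (u x) = 0" by (simp add: u g0)
    then show ?thesis using gpos[OF m] by (simp add: \<eta>_def)
  qed
  have nz: "{x. \<eta> x \<noteq> 0} \<subseteq> cball z b"
  proof
    fix x assume "x \<in> {x. \<eta> x \<noteq> 0}"
    then have "dist x z < b" using zero[of x] by fastforce
    then show "x \<in> cball z b" by (simp add: dist_commute)
  qed
  have "\<eta> \<in> test_functions UNIV"
    using smooth compact_fun_support_subset[OF compact_cball nz] by (simp add: test_functions_def)
  then show ?thesis
    using one fun_support_subset_closed[OF closed_cball nz] by blast
qed

section \<open>Finite combinations of point evaluations\<close>

lemma test_functions_add:
  assumes "subspace V" "\<phi> \<in> test_functions V" "\<psi> \<in> test_functions V"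
  shows "(\<lambda>x. \<phi> x + \<psi> x) \<in> test_functions V"
proof -
  have "{x. \<phi> x + \<psi> x \<noteq> 0} \<subseteq> fun_support \<phi> \<union> fun_support \<psi>"
    using fun_support_superset[of \<phi>] fun_support_superset[of \<psi>] by (auto simp: subset_iff) (metis add_0)
  then have "compact (fun_support (\<lambda>x. \<phi> x + \<psi> x))"
    using assms by (intro compact_fun_support_subset[OF compact_Un]) (auto simp: test_functions_def)
  then show ?thesis
    using assms by (auto simp: test_functions_def smooth_fun_on_iff iter_differentiable_on_add)
qed

lemma test_functions_mult:
  assumes "subspace V" "\<phi> \<in> test_functions V" "smooth_fun_on V \<psi>"
  shows "(\<lambda>x. \<phi> x * \<psi> x) \<in> test_functions V"
proof -
  have "{x. \<phi> x * \<psi> x \<noteq> 0} \<subseteq> fun_support \<phi>"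
    using fun_support_superset[of \<phi>] by auto
  then have "compact (fun_support (\<lambda>x. \<phi> x * \<psi> x))"
    using assms by (intro compact_fun_support_subset) (auto simp: test_functions_def)
  then show ?thesis
    using assms by (auto simp: test_functions_def smooth_fun_on_iff iter_differentiable_on_mult)
qed

lemma test_functions_scale:
  assumes "subspace V" "\<phi> \<in> test_functions V"
  shows "(\<lambda>x. c * \<phi> x) \<in> test_functions V"
  using test_functions_mult[OF assms, of "\<lambda>x. c"] assms(1)
  by (simp add: smooth_fun_on_iff iter_differentiable_on_const mult.commute)

lemma finite_point_evaluations_in_distributions:
  assumes V: "subspace V" and p: "p ` S \<subseteq> V"
  shows "(\<lambda>\<phi>\<in>test_functions V. \<Sum>z\<in>S. c z * \<phi> (p z)) \<in> distributions V"
proof -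
  let ?T = "\<lambda>\<phi>\<in>test_functions V. \<Sum>z\<in>S. c z * \<phi> (p z)"
  have "(\<lambda>n. ?T (\<phi> n)) \<longlonglongrightarrow> 0" if null: "test_null_seq V \<phi>" for \<phi>
  proof -
    \<comment> \<open>Order 0 of the convergence suffices: it gives pointwise convergence on \<open>V\<close>.\<close>
    have "uniform_limit V (\<lambda>n. iter_deriv V [] (\<phi> n)) (\<lambda>_. 0) sequentially"
      using null by (simp add: test_null_seq_def)
    then have "(\<lambda>n. \<phi> n x) \<longlonglongrightarrow> 0" if "x \<in> V" for x
      using that tendsto_uniform_limitI by (fastforce simp: iter_deriv_def)
    then have "(\<lambda>n. \<Sum>z\<in>S. c z * \<phi> n (p z)) \<longlonglongrightarrow> (\<Sum>z\<in>S. c z * 0)"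
      using p by (intro tendsto_intros) auto
    then show ?thesis
      using null by (simp add: test_null_seq_def)
  qed
  then show ?thesis
    using V by (simp add: distributions_def test_functions_add test_functions_scale
        sum.distrib sum_distrib_left algebra_simps)
qed

text \<open>
  The weights may be nonzero off \<open>A\<close>; only their vanishing on \<open>A - B\<close> is needed to make the
  infinite sum finite.
\<close>

lemma dirac_sum_finite:
  assumes "finite B" "B \<subseteq> A" "\<And>a. a \<in> A - B \<Longrightarrow> w a = 0"
  shows "dirac_sum V A w = (\<lambda>\<phi>\<in>test_functions V. \<Sum>a\<in>B. w a * \<phi> a)"
proof -
  have "(\<Sum>\<^sub>\<infinity>a\<in>A. w a * dirac V a \<phi>) = (\<Sum>a\<in>B. w a * \<phi> a)" if "\<phi> \<in> test_functions V" for \<phi>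
  proof -
    have "(\<Sum>\<^sub>\<infinity>a\<in>A. w a * dirac V a \<phi>) = (\<Sum>\<^sub>\<infinity>a\<in>B. w a * \<phi> a)"
      using assms that by (intro infsum_cong_neutral) (auto simp: dirac_def)
    then show ?thesis using assms(1) by simp
  qed
  then show ?thesis unfolding dirac_sum_def by (rule restrict_ext)
qed

text \<open>
  The inclusion of \<open>S\<close> in the support needs cutoff functions that isolate a single point of
  \<open>S\<close>.
\<close>

lemma distr_support_finite_point_evaluations:
  fixes S :: "'a::euclidean_space set"
  assumes S: "finite S" "\<And>z. z \<in> S \<Longrightarrow> c z \<noteq> 0"
  shows "distr_support UNIV (\<lambda>\<phi>\<in>test_functions UNIV. \<Sum>z\<in>S. c z * \<phi> z) = S"
    (is "distr_support UNIV ?T = S")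
proof (intro equalityI subsetI)
  fix x assume x: "x \<in> distr_support UNIV ?T"
  show "x \<in> S"
  proof (rule ccontr)
    assume "x \<notin> S"
    moreover have "open (- S)" using S(1) by (simp add: finite_imp_closed open_Compl)
    ultimately obtain \<phi> where \<phi>: "\<phi> \<in> test_functions UNIV" "fun_support \<phi> \<subseteq> - S" "?T \<phi> \<noteq> 0"
      using x unfolding distr_support_def by blast
    then have "\<phi> z = 0" if "z \<in> S" for z
      using that fun_support_superset[of \<phi>] by blast
    with \<phi> show False by simp
  qed
next
  fix z assume z: "z \<in> S"
  have "\<exists>\<phi>\<in>test_functions UNIV. fun_support \<phi> \<subseteq> U \<and> ?T \<phi> \<noteq> 0" if "open U" "z \<in> U" for U
  proof -
    have "open (U - (S - {z}))" "z \<in> U - (S - {z})"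
      using that S(1) by (auto intro: open_Diff finite_imp_closed)
    then obtain e where e: "e > 0" "cball z e \<subseteq> U - (S - {z})"
      using open_contains_cball by blast
    from e(1) have "0 < e / 2" "e / 2 < e" by auto
    from smooth_cutoff_exists[OF this, of z] obtain \<eta>
      where \<eta>: "\<eta> \<in> test_functions UNIV" "\<forall>x. dist x z \<le> e / 2 \<longrightarrow> \<eta> x = 1"
        "fun_support \<eta> \<subseteq> cball z e"
      by blast
    have "\<eta> y = 0" if "y \<in> S - {z}" for y
      using that e \<eta>(3) fun_support_superset[of \<eta>] by blast
    then have "(\<Sum>y\<in>S. c y * \<eta> y) = c z"
      using S(1) z \<eta>(2) e(1) by (simp add: sum.remove[of S z])
    then show ?thesis
      using \<eta> e S(2) z by (intro bexI[of _ \<eta>]) auto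
  qed
  then show "z \<in> distr_support UNIV ?T"
    by (simp add: distr_support_def)
qed

lemma distr_pairing_finite_point_evaluations:
  fixes S :: "'a::euclidean_space set"
  assumes S: "finite S" "\<And>z. z \<in> S \<Longrightarrow> c z \<noteq> 0" and \<psi>: "smooth_fun_on UNIV \<psi>"
  shows "distr_pairing UNIV (\<lambda>\<phi>\<in>test_functions UNIV. \<Sum>z\<in>S. c z * \<phi> z) \<psi> = (\<Sum>z\<in>S. c z * \<psi> z)"
    (is "distr_pairing UNIV ?T \<psi> = ?c")
proof -
  have pairing: "?T (\<lambda>x. \<eta> x * \<psi> x) = ?c"
    if "\<eta> \<in> test_functions UNIV" "S \<subseteq> U" "\<forall>x\<in>U. \<eta> x = 1" for \<eta> U
  proof -
    have "(\<Sum>z\<in>S. c z * (\<eta> z * \<psi> z)) = ?c"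
      using that by (intro sum.cong) auto
    then show ?thesis
      using test_functions_mult[OF subspace_UNIV that(1) \<psi>] by simp
  qed
  obtain R where R: "R > 0" "S \<subseteq> ball 0 R"
    using finite_imp_bounded[OF S(1)] bounded_subset_ballD by blast
  have "R < R + 1" by simp
  from smooth_cutoff_exists[OF R(1) this, of 0] obtain \<eta> :: "'a \<Rightarrow> complex"
    where \<eta>: "\<eta> \<in> test_functions UNIV" "\<forall>x. dist x 0 \<le> R \<longrightarrow> \<eta> x = 1"
    by blast
  have \<eta>': "\<exists>U. open U \<and> S \<subseteq> U \<and> (\<forall>x\<in>U. \<eta> x = 1)"
    using R(2) \<eta>(2) by (intro exI[of _ "ball 0 R"]) auto
  have supp: "distr_support UNIV ?T = S"
    by (rule distr_support_finite_point_evaluations[OF S])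
  show ?thesis
    unfolding distr_pairing_def supp
  proof (intro the_equality ballI impI)
    fix \<eta> :: "'a \<Rightarrow> complex"
    assume "\<eta> \<in> test_functions UNIV" "\<exists>U. open U \<and> S \<subseteq> U \<and> (\<forall>x\<in>U \<inter> UNIV. \<eta> x = 1)"
    then show "?T (\<lambda>x. \<eta> x * \<psi> x) = ?c"
      unfolding Int_UNIV_right using pairing by (elim exE conjE)
  next
    fix d
    assume "\<forall>\<eta>\<in>test_functions UNIV. (\<exists>U. open U \<and> S \<subseteq> U \<and> (\<forall>x\<in>U \<inter> UNIV. \<eta> x = 1)) \<longrightarrow>
        ?T (\<lambda>x. \<eta> x * \<psi> x) = d"
    with \<eta>(1) \<eta>' have "?T (\<lambda>x. \<eta> x * \<psi> x) = d" by simp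
    moreover have "?T (\<lambda>x. \<eta> x * \<psi> x) = ?c"
      using \<eta>(1) \<eta>' pairing by blast
    ultimately show "d = ?c" by (rule subst)
  qed
qed

section \<open>Lattice points and the X-ray transforms\<close>

lemma subspace_hyperplane: "subspace (hyperplane \<theta>)"
  by (auto simp: hyperplane_def subspace_def inner_add_left)

lemma finite_int_lattice_cball: "finite (cball 0 r \<inter> int_lattice :: (real ^ 'n) set)"
proof -
  define F where "F = (PiE UNIV (\<lambda>_. {- \<lceil>r\<rceil>..\<lceil>r\<rceil>}) :: ('n \<Rightarrow> int) set)"
  have "cball 0 r \<inter> int_lattice \<subseteq> (\<lambda>k. \<chi> i. of_int (k i)) ` F"
  proof
    fix z :: "real ^ 'n" assume z: "z \<in> cball 0 r \<inter> int_lattice"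
    have "\<lfloor>z $ i\<rfloor> \<in> {- \<lceil>r\<rceil>..\<lceil>r\<rceil>}" for i
    proof -
      have "\<bar>z $ i\<bar> \<le> r" using z component_le_norm_cart[of z i] by simp
      then show ?thesis by (simp add: abs_le_iff) linarith
    qed
    moreover have "z = (\<chi> i. of_int \<lfloor>z $ i\<rfloor>)"
      using z by (auto simp: vec_eq_iff int_lattice_def elim!: Ints_cases)
    ultimately show "z \<in> (\<lambda>k. \<chi> i. of_int (k i)) ` F"
      unfolding F_def by (intro image_eqI[where x = "\<lambda>i. \<lfloor>z $ i\<rfloor>"]) auto
  qed
  moreover have "finite F" unfolding F_def by (intro finite_PiE) auto
  ultimately show ?thesis by (rule finite_surj[rotated])
qed

lemma xray_dis_eq_sum_fibre:
  fixes \<theta> :: "real ^ 'n"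
  assumes \<theta>: "norm \<theta> = 1" and x: "x \<in> hyperplane \<theta>"
    and S: "finite {z \<in> int_lattice. g z \<noteq> 0}" (is "finite ?S")
  shows "xray_dis g \<theta> x = (\<Sum>z | z \<in> ?S \<and> hproj \<theta> z = x. g z)"
proof -
  have \<theta>\<theta>: "\<theta> \<bullet> \<theta> = 1" using \<theta> by (simp add: norm_eq_1)
  \<comment> \<open>The fibre of the projection over \<open>x\<close> is the line \<open>x + s \<theta>\<close>, with \<open>s = z \<bullet> \<theta>\<close>.\<close>
  have bij: "bij_betw (\<lambda>s. x + s *\<^sub>R \<theta>) {s. x + s *\<^sub>R \<theta> \<in> ?S} {z \<in> ?S. hproj \<theta> z = x}"
    using x by (intro bij_betw_byWitness[where f' = "\<lambda>z. z \<bullet> \<theta>"])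
      (auto simp: hproj_def hyperplane_def inner_add_left \<theta>\<theta>)
  have fin: "finite {s. x + s *\<^sub>R \<theta> \<in> ?S}"
    unfolding bij_betw_finite[OF bij] using S by (rule rev_finite_subset) auto
  have "xray_dis g \<theta> x = (\<Sum>\<^sub>\<infinity>s\<in>{s. x + s *\<^sub>R \<theta> \<in> ?S}. g (x + s *\<^sub>R \<theta>))"
    unfolding xray_dis_def by (rule infsum_cong_neutral) auto
  also have "\<dots> = (\<Sum>s | x + s *\<^sub>R \<theta> \<in> ?S. g (x + s *\<^sub>R \<theta>))"
    using fin by (rule infsum_finite)
  also have "\<dots> = (\<Sum>z | z \<in> ?S \<and> hproj \<theta> z = x. g z)"
    by (rule sum.reindex_bij_betw[OF bij])
  finally show ?thesis .
qed

lemma dirac_sum_xray_dis: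
  fixes \<theta> :: "real ^ 'n"
  assumes \<theta>: "norm \<theta> = 1" and S: "finite {z \<in> int_lattice. g z \<noteq> 0}" (is "finite ?S")
  shows "dirac_sum (hyperplane \<theta>) (hyperplane_dis \<theta>) (xray_dis g \<theta>) =
    (\<lambda>\<phi>\<in>test_functions (hyperplane \<theta>). \<Sum>z\<in>?S. g z * \<phi> (hproj \<theta> z))"
proof -
  have hp: "hproj \<theta> z \<in> hyperplane \<theta>" for z
    using hproj_orthogonal_projection(1)[OF \<theta>] .
  have fibre: "xray_dis g \<theta> (hproj \<theta> z) = (\<Sum>y | y \<in> ?S \<and> hproj \<theta> y = hproj \<theta> z. g y)" for z
    using xray_dis_eq_sum_fibre[OF \<theta> hp S] .
  have zero: "xray_dis g \<theta> a = 0" if a: "a \<in> hyperplane_dis \<theta> - hproj \<theta> ` ?S" for a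
  proof -
    obtain z where z: "a = hproj \<theta> z" using a by (auto simp: hyperplane_dis_def)
    have "{y. y \<in> ?S \<and> hproj \<theta> y = hproj \<theta> z} = {}"
      using a unfolding z by (auto simp: image_iff)
    then show ?thesis by (simp only: z fibre sum.empty)
  qed
  have "dirac_sum (hyperplane \<theta>) (hyperplane_dis \<theta>) (xray_dis g \<theta>) =
      (\<lambda>\<phi>\<in>test_functions (hyperplane \<theta>). \<Sum>a\<in>hproj \<theta> ` ?S. xray_dis g \<theta> a * \<phi> a)"
  proof (rule dirac_sum_finite[OF finite_imageI[OF S] _ zero])
    show "hproj \<theta> ` ?S \<subseteq> hyperplane_dis \<theta>"
      unfolding hyperplane_dis_def by (rule image_mono) blast
  qed
  moreover have "(\<Sum>a\<in>hproj \<theta> ` ?S. xray_dis g \<theta> a * \<phi> a) = (\<Sum>z\<in>?S. g z * \<phi> (hproj \<theta> z))" for \<phi>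
  proof -
    have "(\<Sum>z\<in>?S. g z * \<phi> (hproj \<theta> z)) =
        (\<Sum>a\<in>hproj \<theta> ` ?S. \<Sum>z | z \<in> ?S \<and> hproj \<theta> z = a. g z * \<phi> (hproj \<theta> z))"
      using S by (rule sum.image_gen)
    also have "\<dots> = (\<Sum>a\<in>hproj \<theta> ` ?S. xray_dis g \<theta> a * \<phi> a)"
    proof (rule sum.cong[OF refl])
      fix a assume "a \<in> hproj \<theta> ` ?S"
      then obtain y where y: "a = hproj \<theta> y" by blast
      show "(\<Sum>z | z \<in> ?S \<and> hproj \<theta> z = a. g z * \<phi> (hproj \<theta> z)) = xray_dis g \<theta> a * \<phi> a"
        unfolding y fibre sum_distrib_right by (rule sum.cong) auto
    qed
    finally show ?thesis by (rule sym)
  qed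
  ultimately show ?thesis by (simp only:)
qed

lemma smooth_fun_on_compose_hproj:
  assumes \<theta>: "norm \<theta> = 1" and \<phi>: "\<phi> \<in> test_functions (hyperplane \<theta>)"
  shows "smooth_fun_on UNIV (\<phi> \<circ> hproj \<theta>)"
proof -
  have "bounded_linear (hproj \<theta>)"
    unfolding linear_conv_bounded_linear[symmetric]
    by (rule linearI) (simp_all add: hproj_def inner_add_left algebra_simps)
  moreover have "hproj \<theta> ` UNIV \<subseteq> hyperplane \<theta>"
    using hproj_orthogonal_projection(1)[OF \<theta>] by blast
  moreover have "iter_differentiable_on (hyperplane \<theta>) n \<phi>" for n
    using \<phi> by (simp add: test_functions_def smooth_fun_on_iff)
  ultimately have "iter_differentiable_on UNIV n (\<phi> \<circ> hproj \<theta>)" for n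
    by (rule iter_differentiable_on_compose_linear[OF subspace_UNIV])
  then show ?thesis
    by (simp add: smooth_fun_on_iff)
qed

theorem theorem3p2:
  fixes r :: real
    and fdis :: "real ^ 'n \<Rightarrow> complex"
    and f :: "(real ^ 'n \<Rightarrow> complex) \<Rightarrow> complex"
  assumes "CARD('n) \<ge> 2"
    and "r > 0"
    and "{z \<in> int_lattice. fdis z \<noteq> 0} \<subseteq> cball 0 r \<inter> int_lattice"
    and "f = dirac_sum UNIV int_lattice fdis"
  shows "f \<in> compact_distributions UNIV \<and>
    (\<forall>\<theta> \<in> sphere 0 1.
       xray_con f \<theta> \<in> distributions (hyperplane \<theta>) \<and>
       xray_con f \<theta> = dirac_sum (hyperplane \<theta>) (hyperplane_dis \<theta>) (xray_dis fdis \<theta>))"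
proof -
  define S where "S = {z \<in> int_lattice. fdis z \<noteq> 0}"
  have S: "finite S" "\<And>z. z \<in> S \<Longrightarrow> fdis z \<noteq> 0"
    unfolding S_def by (rule finite_subset[OF assms(3) finite_int_lattice_cball]) blast
  have f: "f = (\<lambda>\<phi>\<in>test_functions UNIV. \<Sum>z\<in>S. fdis z * \<phi> z)"
    unfolding assms(4)
  proof (rule dirac_sum_finite[OF S(1)])
    show "S \<subseteq> int_lattice" "\<And>a. a \<in> int_lattice - S \<Longrightarrow> fdis a = 0"
      by (auto simp: S_def)
  qed
  have "f \<in> distributions UNIV"
    unfolding f by (rule finite_point_evaluations_in_distributions) simp_all
  moreover have "distr_support UNIV f = S"
    unfolding f by (rule distr_support_finite_point_evaluations[OF S])
  ultimately have "f \<in> compact_distributions UNIV"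
    unfolding compact_distributions_def using finite_imp_compact[OF S(1)] by simp
  moreover have
    "xray_con f \<theta> \<in> distributions (hyperplane \<theta>) \<and>
     xray_con f \<theta> = dirac_sum (hyperplane \<theta>) (hyperplane_dis \<theta>) (xray_dis fdis \<theta>)"
    if "\<theta> \<in> sphere 0 1" for \<theta>
  proof -
    have \<theta>: "norm \<theta> = 1" using that by simp
    have "distr_pairing UNIV f (\<phi> \<circ> hproj \<theta>) = (\<Sum>z\<in>S. fdis z * \<phi> (hproj \<theta> z))"
      if "\<phi> \<in> test_functions (hyperplane \<theta>)" for \<phi>
      unfolding f o_apply[of \<phi> "hproj \<theta>", symmetric]
      by (rule distr_pairing_finite_point_evaluations[OF S smooth_fun_on_compose_hproj[OF \<theta> that]])
    then have con: "xray_con f \<theta> =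
        (\<lambda>\<phi>\<in>test_functions (hyperplane \<theta>). \<Sum>z\<in>S. fdis z * \<phi> (hproj \<theta> z))"
      unfolding xray_con_def by (rule restrict_ext)
    have "xray_con f \<theta> \<in> distributions (hyperplane \<theta>)"
      unfolding con
    proof (rule finite_point_evaluations_in_distributions[OF subspace_hyperplane])
      show "hproj \<theta> ` S \<subseteq> hyperplane \<theta>"
        using hproj_orthogonal_projection(1)[OF \<theta>] by blast
    qed
    moreover have "xray_con f \<theta> =
        dirac_sum (hyperplane \<theta>) (hyperplane_dis \<theta>) (xray_dis fdis \<theta>)"
      unfolding con S_def
      by (rule dirac_sum_xray_dis[OF \<theta> S(1)[unfolded S_def], symmetric])
    ultimately show ?thesis ..
  qed
  ultimately show ?thesis by blast
qed

end
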